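(* The parameters $(q,c)$ are feasible for all integers $q\ge 1$ when $c$ takes any one of the values $q$, $q^2$, $q^2+q$, and for all integers $q\ge 2$ when $c=q^2-q$.
   Context: A pair $(q,c)$ of positive integers is called feasible (as parameters for a strongly regular graph with no triangles) if $1\le c\le q(q+1)$ and the following two conditions hold: (i) $c$ divides $q^4-q^2$; (ii) $c+2q$ divides the integer $q^4+3q^3+5q^2+3q+q\,(q^4-q^2)/c$. *)

theory Defs
  imports Main
begin

(* The pair is taken over the integers so that q^4 - q^2 and q^2 - q are not truncated
   subtractions. The quotient by c is exact because of the preceding conjunct. *)
definition feasible :: "int \<Rightarrow> int \<Rightarrow> bool" where
  "feasible q c \<longleftrightarrow>
     0 < q \<and> 0 < c \<and> 1 \<le> c \<and> c \<le> q * (q + 1) \<and>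
     c dvd q ^ 4 - q ^ 2 \<and>
     c + 2 * q dvd q ^ 4 + 3 * q ^ 3 + 5 * q ^ 2 + 3 * q + q * (q ^ 4 - q ^ 2) div c"

end

theory Submission
  imports Defs
begin

text \<open>
  Each of the four values of \<open>c\<close> divides \<open>q\<^sup>4 - q\<^sup>2 = q\<^sup>2 (q - 1) (q + 1)\<close> with a quotient \<open>k\<close>
  that is a polynomial in \<open>q\<close>. Substituting \<open>k\<close> turns the second feasibility condition into the
  divisibility of one polynomial in \<open>q\<close> by \<open>c + 2 q\<close>:

  \<^item> \<open>c = q\<^sup>2\<close>: \<open>c + 2 q = q (q + 2)\<close> divides \<open>q (q + 2) (q + 1)\<^sup>2\<close>;
  \<^item> \<open>c = q\<^sup>2 + q\<close>: \<open>c + 2 q = q (q + 3)\<close> divides \<open>q (q + 3) (q\<^sup>2 + q + 1)\<close>;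
  \<^item> \<open>c = q\<^sup>2 - q\<close>: \<open>c + 2 q = q (q + 1)\<close> divides \<open>q (q + 1) (q\<^sup>2 + 3 q + 3)\<close>;
  \<^item> \<open>c = q\<close>: \<open>c + 2 q = 3 q\<close> divides \<open>q (2 q\<^sup>3 + 3 q\<^sup>2 + 4 q + 3)\<close>.

  The first three are polynomial identities. The last one is arithmetical: modulo 3 the cofactor
  of \<open>q\<close> is \<open>2 (q\<^sup>3 - q)\<close>, a multiple of 3 by Fermat's little theorem.
\<close>

text \<open>
  Naming both quotients \<open>k\<close> and \<open>m\<close> removes the integer division from the definition, so that
  feasibility is reduced to bounds and two ring identities.
\<close>

lemma feasible_if_quotients:
  fixes q c k m :: int
  assumes "0 < q" "0 < c" "c \<le> q * (q + 1)"
    and k: "q ^ 4 - q ^ 2 = c * k"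
    and m: "q ^ 4 + 3 * q ^ 3 + 5 * q ^ 2 + 3 * q + q * k = (c + 2 * q) * m"
  shows "feasible q c"
proof -
  have "q * (q ^ 4 - q ^ 2) div c = q * k"
    using \<open>0 < c\<close> by (simp add: k mult.left_commute)
  then show ?thesis
    using assms by (simp add: feasible_def)
qed

lemma three_dvd_cube_minus_self: "(3::int) dvd q ^ 3 - q"
proof -
  have "q mod 3 = 0 \<or> q mod 3 = 1 \<or> q mod 3 = 2"
    by presburger
  then have "3 dvd q \<or> 3 dvd q - 1 \<or> 3 dvd q + 1"
    by presburger
  moreover have "q ^ 3 - q = q * (q - 1) * (q + 1)"
    by (simp add: algebra_simps power3_eq_cube)
  ultimately show ?thesis
    by auto
qed

lemma feasible_self:
  assumes "1 \<le> q"
  shows "feasible q q"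
proof -
  obtain t where t: "q ^ 3 - q = 3 * t"
    using three_dvd_cube_minus_self by (auto elim: dvdE)
  show ?thesis
  proof (rule feasible_if_quotients)
    show "q ^ 4 - q ^ 2 = q * (q ^ 3 - q)"
      by algebra
    show "q ^ 4 + 3 * q ^ 3 + 5 * q ^ 2 + 3 * q + q * (q ^ 3 - q)
        = (q + 2 * q) * (2 * t + q ^ 2 + 2 * q + 1)"
      using t by algebra
  qed (use assms in \<open>auto simp: algebra_simps\<close>)
qed

lemma feasible_square:
  assumes "1 \<le> q"
  shows "feasible q (q ^ 2)"
proof (rule feasible_if_quotients)
  show "q ^ 4 - q ^ 2 = q ^ 2 * (q ^ 2 - 1)"
    by algebra
  show "q ^ 4 + 3 * q ^ 3 + 5 * q ^ 2 + 3 * q + q * (q ^ 2 - 1)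
      = (q ^ 2 + 2 * q) * (q + 1) ^ 2"
    by algebra
qed (use assms in \<open>auto simp: algebra_simps power2_eq_square\<close>)

lemma feasible_square_plus_self:
  assumes "1 \<le> q"
  shows "feasible q (q ^ 2 + q)"
proof (rule feasible_if_quotients)
  show "q ^ 4 - q ^ 2 = (q ^ 2 + q) * (q ^ 2 - q)"
    by algebra
  show "q ^ 4 + 3 * q ^ 3 + 5 * q ^ 2 + 3 * q + q * (q ^ 2 - q)
      = (q ^ 2 + q + 2 * q) * (q ^ 2 + q + 1)"
    by algebra
  show "0 < q ^ 2 + q"
    using assms by (simp add: add_nonneg_pos)
qed (use assms in \<open>auto simp: algebra_simps power2_eq_square\<close>)

lemma feasible_square_minus_self:
  assumes "2 \<le> q"
  shows "feasible q (q ^ 2 - q)"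
proof (rule feasible_if_quotients)
  show "q ^ 4 - q ^ 2 = (q ^ 2 - q) * (q ^ 2 + q)"
    by algebra
  show "q ^ 4 + 3 * q ^ 3 + 5 * q ^ 2 + 3 * q + q * (q ^ 2 + q)
      = (q ^ 2 - q + 2 * q) * (q ^ 2 + 3 * q + 3)"
    by algebra
  have "0 < q * (q - 1)"
    using assms by simp
  then show "0 < q ^ 2 - q"
    by (simp add: algebra_simps power2_eq_square)
qed (use assms in \<open>auto simp: algebra_simps power2_eq_square\<close>)

theorem theorem5:
  shows "(\<forall>q::int. 1 \<le> q \<longrightarrow>
            (\<forall>c \<in> {q, q ^ 2, q ^ 2 + q}. feasible q c)) \<and>
         (\<forall>q::int. 2 \<le> q \<longrightarrow> feasible q (q ^ 2 - q))"
  using feasible_self feasible_square feasible_square_plus_self feasible_square_minus_self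
  by blast

end
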